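(* Let $k$ be a positive integer and let $G$ be a connected graph of order $n$ with minimum degree $\delta$. 1. If $n \geq 2k + 6$ and \[ q(G) \geq q\bigl(K_{2k} \vee (K_{n - 2k - 1} \cup K_1)\bigr), \] then $G$ is fractional $k$-extendable, unless $G \cong K_{2k} \vee (K_{n - 2k - 1} \cup K_1)$. 2. If $n \geq 6.5\delta$, $\delta \geq 2k + 1$ and \[ q(G) \geq q\bigl(K_{\delta} \vee (K_{n - 2\delta + 2k - 1} \cup (\delta - 2k + 1)K_1)\bigr), \] then $G$ is fractional $k$-extendable, unless $G \cong K_{\delta} \vee (K_{n - 2\delta + 2k - 1} \cup (\delta - 2k + 1)K_1)$.
   Context: All graphs are finite and simple. The signless Laplacian matrix of $G$ is $Q(G) = D(G) + A(G)$, where $D(G)$ is the diagonal matrix of vertex degrees and $A(G)$ is the adjacency matrix; $q(G)$ (the signless Laplacian spectral radius) is the largest eigenvalue of $Q(G)$. $K_m$ is the complete graph on $m$ vertices, $\cup$ denotes disjoint union of graphs, $tK_1$ is the graph with $t$ vertices and no edges, and the join $G_1 \vee G_2$ is obtained from the disjoint union of $G_1$ and $G_2$ by adding every edge between $V(G_1)$ and $V(G_2)$. A $k$-matching is a set of $k$ pairwise vertex-disjoint edges. A fractional perfect matching of $G$ is a function $h: E(G) \to [0,1]$ such that $\sum_{e \in E_G(v)} h(e) = 1$ for every $v \in V(G)$, where $E_G(v)$ is the set of edges incident with $v$. A graph $G$ with at least $2k+2$ vertices is fractional $k$-extendable if it has a $k$-matching and for every $k$-matching $M$ of $G$ there is a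 fractional perfect matching $h$ of $G$ with $h(e) = 1$ for all $e \in M$. *)

theory Defs
  imports
    "Graph_Theory.Graph_Theory"
    "Jordan_Normal_Form.Char_Poly"
begin

(* A finite simple graph is a pair_graph: a finite vertex set pverts with a finite, symmetric and
   irreflexive relation parcs on it. An undirected edge uv is the two-element set {u, v}. *)

definition ugraph_edges :: "'a pair_pre_digraph \<Rightarrow> 'a set set" where
  "ugraph_edges G = {{u, v} | u v. (u, v) \<in> parcs G}"

definition incident_edges :: "'a pair_pre_digraph \<Rightarrow> 'a \<Rightarrow> 'a set set" where
  "incident_edges G v = {e \<in> ugraph_edges G. v \<in> e}"

definition vertex_degree :: "'a pair_pre_digraph \<Rightarrow> 'a \<Rightarrow> nat" where
  "vertex_degree G v = card (incident_edges G v)"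

definition min_degree :: "'a pair_pre_digraph \<Rightarrow> nat" where
  "min_degree G = Min (vertex_degree G ` pverts G)"


definition complete_ugraph :: "nat \<Rightarrow> nat pair_pre_digraph" where
  "complete_ugraph m =
     \<lparr>pverts = {..<m}, parcs = {(u, v). u < m \<and> v < m \<and> u \<noteq> v}\<rparr>"

definition edgeless_ugraph :: "nat \<Rightarrow> nat pair_pre_digraph" where
  "edgeless_ugraph t = \<lparr>pverts = {..<t}, parcs = {}\<rparr>"

definition disjoint_union ::
  "'a pair_pre_digraph \<Rightarrow> 'b pair_pre_digraph \<Rightarrow> ('a + 'b) pair_pre_digraph" where
  "disjoint_union G H =
     \<lparr>pverts = pverts G <+> pverts H,
      parcs = map_prod Inl Inl ` parcs G \<union> map_prod Inr Inr ` parcs H\<rparr>"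

definition graph_join ::
  "'a pair_pre_digraph \<Rightarrow> 'b pair_pre_digraph \<Rightarrow> ('a + 'b) pair_pre_digraph" where
  "graph_join G H =
     \<lparr>pverts = pverts G <+> pverts H,
      parcs = parcs (disjoint_union G H)
        \<union> (Inl ` pverts G) \<times> (Inr ` pverts H) \<union> (Inr ` pverts H) \<times> (Inl ` pverts G)\<rparr>"


(* The matrices are written with respect to a list vs enumerating the vertices. *)

definition adjacency_matrix :: "'a pair_pre_digraph \<Rightarrow> 'a list \<Rightarrow> real mat" where
  "adjacency_matrix G vs =
     mat (length vs) (length vs) (\<lambda>(i, j). if (vs ! i, vs ! j) \<in> parcs G then 1 else 0)"

definition degree_matrix :: "'a pair_pre_digraph \<Rightarrow> 'a list \<Rightarrow> real mat" where
  "degree_matrix G vs =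
     mat (length vs) (length vs) (\<lambda>(i, j). if i = j then real (vertex_degree G (vs ! i)) else 0)"

definition signless_laplacian :: "'a pair_pre_digraph \<Rightarrow> 'a list \<Rightarrow> real mat" where
  "signless_laplacian G vs = degree_matrix G vs + adjacency_matrix G vs"

definition vertex_enum :: "'a pair_pre_digraph \<Rightarrow> 'a list" where
  "vertex_enum G = (SOME vs. distinct vs \<and> set vs = pverts G)"

(* The matrix is real symmetric, so for a nonempty graph this set of eigenvalues is finite and
   nonempty. By eigenvalue_signless_laplacian_iff below, it does not depend on the enumeration. *)
definition signless_laplacian_radius :: "'a pair_pre_digraph \<Rightarrow> real" where
  "signless_laplacian_radius G = Max {x. eigenvalue (signless_laplacian G (vertex_enum G)) x}"


definition is_matching :: "'a pair_pre_digraph \<Rightarrow> nat \<Rightarrow> 'a set set \<Rightarrow> bool" where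
  "is_matching G k M \<longleftrightarrow>
     M \<subseteq> ugraph_edges G \<and> finite M \<and> card M = k \<and> pairwise disjnt M"

(* Values of h outside the edge set are irrelevant. *)
definition fractional_perfect_matching :: "'a pair_pre_digraph \<Rightarrow> ('a set \<Rightarrow> real) \<Rightarrow> bool" where
  "fractional_perfect_matching G h \<longleftrightarrow>
     (\<forall>e \<in> ugraph_edges G. 0 \<le> h e \<and> h e \<le> 1) \<and>
     (\<forall>v \<in> pverts G. (\<Sum>e \<in> incident_edges G v. h e) = 1)"

definition fractional_extendable :: "nat \<Rightarrow> 'a pair_pre_digraph \<Rightarrow> bool" where
  "fractional_extendable k G \<longleftrightarrow>
     2 * k + 2 \<le> card (pverts G) \<and>
     (\<exists>M. is_matching G k M) \<and>
     (\<forall>M. is_matching G k M \<longrightarrow>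
        (\<exists>h. fractional_perfect_matching G h \<and> (\<forall>e \<in> M. h e = 1)))"


lemma pair_graph_complete_ugraph: "pair_graph (complete_ugraph m)"
proof -
  have "finite {(u, v). u < m \<and> v < m \<and> u \<noteq> v}"
    by (rule finite_subset[of _ "{..<m} \<times> {..<m}"]) auto
  then show ?thesis
    by unfold_locales (auto simp: complete_ugraph_def symmetric_def sym_def)
qed

lemma pair_graph_edgeless_ugraph: "pair_graph (edgeless_ugraph t)"
  by unfold_locales (auto simp: edgeless_ugraph_def symmetric_def sym_def)

lemma pair_graph_disjoint_union:
  assumes "pair_graph G" "pair_graph H"
  shows "pair_graph (disjoint_union G H)"
proof -
  interpret G: pair_graph G by fact
  interpret H: pair_graph H by fact
  show ?thesis
    using G.pair_sym_arcs H.pair_sym_arcs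
    by unfold_locales
      (auto simp: disjoint_union_def symmetric_def sym_def
        dest: G.wellformed' H.wellformed' G.pair_no_loops H.pair_no_loops)
qed

lemma pair_graph_graph_join:
  assumes "pair_graph G" "pair_graph H"
  shows "pair_graph (graph_join G H)"
proof -
  interpret G: pair_graph G by fact
  interpret H: pair_graph H by fact
  show ?thesis
    using G.pair_sym_arcs H.pair_sym_arcs
    by unfold_locales
      (auto simp: graph_join_def disjoint_union_def symmetric_def sym_def
        dest: G.wellformed' H.wellformed' G.pair_no_loops H.pair_no_loops)
qed

lemma vertex_enum:
  assumes "finite (pverts G)"
  shows "distinct (vertex_enum G)" "set (vertex_enum G) = pverts G"
proof -
  have "\<exists>vs. distinct vs \<and> set vs = pverts G"
    using finite_distinct_list[OF assms] by blast
  then have "distinct (vertex_enum G) \<and> set (vertex_enum G) = pverts G"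
    unfolding vertex_enum_def by (rule someI_ex)
  then show "distinct (vertex_enum G)" "set (vertex_enum G) = pverts G" by auto
qed

lemma signless_laplacian_mult_index:
  assumes "distinct vs" "set vs = pverts G" "i < length vs"
  shows "(signless_laplacian G vs *\<^sub>v vec (length vs) (\<lambda>j. f (vs ! j))) $ i =
     real (vertex_degree G (vs ! i)) * f (vs ! i)
       + (\<Sum>u \<in> {u \<in> pverts G. (vs ! i, u) \<in> parcs G}. f u)"
proof -
  let ?n = "length vs" and ?v = "vs ! i"
  let ?d = "real (vertex_degree G ?v)"
  have "(signless_laplacian G vs *\<^sub>v vec ?n (\<lambda>j. f (vs ! j))) $ i =
      (\<Sum>j<?n. ((if i = j then ?d else 0) + (if (?v, vs ! j) \<in> parcs G then 1 else 0)) * f (vs ! j))"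
    using assms(3)
    by (simp add: signless_laplacian_def degree_matrix_def adjacency_matrix_def scalar_prod_def
        atLeast0LessThan)
  also have "\<dots> = (\<Sum>j<?n. (if j = i then ?d * f (vs ! j) else 0)
      + (if (?v, vs ! j) \<in> parcs G then f (vs ! j) else 0))"
    by (intro sum.cong) (auto simp: algebra_simps)
  also have "\<dots> = ?d * f ?v + (\<Sum>j<?n. if (?v, vs ! j) \<in> parcs G then f (vs ! j) else 0)"
    using assms(3) by (simp add: sum.distrib)
  also have "(\<Sum>j<?n. if (?v, vs ! j) \<in> parcs G then f (vs ! j) else 0) =
      (\<Sum>u \<in> pverts G. if (?v, u) \<in> parcs G then f u else 0)"
    by (rule sum.reindex_bij_betw[OF bij_betw_nth[OF assms(1) refl, of "pverts G", simplified assms(2)]])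
      simp
  also have "\<dots> = (\<Sum>u \<in> {u \<in> pverts G. (?v, u) \<in> parcs G}. f u)"
    using assms(2) by (simp add: sum.inter_filter flip: assms(2))
  finally show ?thesis .
qed

lemma eigenvalue_signless_laplacian_iff:
  assumes "distinct vs" "set vs = pverts G"
  shows "eigenvalue (signless_laplacian G vs) x \<longleftrightarrow>
    (\<exists>f. (\<exists>v \<in> pverts G. f v \<noteq> 0) \<and>
      (\<forall>v \<in> pverts G. real (vertex_degree G v) * f v
         + (\<Sum>u \<in> {u \<in> pverts G. (v, u) \<in> parcs G}. f u) = x * f v))"
    (is "_ \<longleftrightarrow> (\<exists>f. ?P f)")
proof -
  let ?n = "length vs" and ?Q = "signless_laplacian G vs"
  have dim: "dim_row ?Q = ?n" "dim_col ?Q = ?n"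
    by (auto simp: signless_laplacian_def degree_matrix_def adjacency_matrix_def)
  have iff: "eigenvector ?Q (vec ?n (\<lambda>j. f (vs ! j))) x \<longleftrightarrow> ?P f" for f
  proof -
    have "vec ?n (\<lambda>j. f (vs ! j)) = 0\<^sub>v ?n \<longleftrightarrow> (\<forall>v \<in> pverts G. f v = 0)"
      by (auto simp: vec_eq_iff all_set_conv_all_nth simp flip: assms(2))
    moreover have "?Q *\<^sub>v vec ?n (\<lambda>j. f (vs ! j)) = x \<cdot>\<^sub>v vec ?n (\<lambda>j. f (vs ! j)) \<longleftrightarrow>
        (\<forall>i < ?n. (?Q *\<^sub>v vec ?n (\<lambda>j. f (vs ! j))) $ i = x * f (vs ! i))"
      using dim by (auto simp: vec_eq_iff)
    moreover have "\<dots> \<longleftrightarrow> (\<forall>v \<in> pverts G. real (vertex_degree G v) * f v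
         + (\<Sum>u \<in> {u \<in> pverts G. (v, u) \<in> parcs G}. f u) = x * f v)"
      using signless_laplacian_mult_index[OF assms, of _ f] assms(2)[symmetric]
      by (simp add: all_set_conv_all_nth)
    ultimately show ?thesis by (auto simp: eigenvector_def dim)
  qed
  have ex: "\<exists>f. w = vec ?n (\<lambda>j. f (vs ! j))" if "w \<in> carrier_vec ?n" for w :: "real vec"
    using that assms(1)
    by (intro exI[of _ "\<lambda>v. w $ (the_inv_into {..<?n} ((!) vs) v)"])
      (auto simp: vec_eq_iff the_inv_into_f_f inj_on_nth)
  show ?thesis
  proof
    assume "eigenvalue ?Q x"
    then obtain w where w: "eigenvector ?Q w x" by (auto simp: eigenvalue_def)
    then have "w \<in> carrier_vec ?n" by (simp add: eigenvector_def dim)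
    then obtain f where "w = vec ?n (\<lambda>j. f (vs ! j))" using ex by blast
    with w have "?P f" using iff[of f] by blast
    then show "\<exists>f. ?P f" by blast
  next
    assume "\<exists>f. ?P f"
    then obtain f where "?P f" by blast
    then show "eigenvalue ?Q x" using iff[of f] unfolding eigenvalue_def by blast
  qed
qed

end

theory Submission
  imports Defs "Jordan_Normal_Form.Spectral_Radius"
begin

text \<open>
  Write n for the order of the graph and H(s, c, t) = K_s \<or> (K_c \<union> t K_1).

  If a graph is not fractional k-extendable, then some set S of s \<ge> 2k vertices leaves at
  least s - 2k + 1 isolated vertices behind (\<open>not_fractional_extendable_obtains\<close>): a
  fractional perfect matching containing a k-matching exists as soon as Hall's condition holds for
  the neighbourhoods in the graph without the matched vertices, and a violating set contains an
  independent set with too few neighbours. So the graph is a spanning subgraph of H(s, c, t) with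
  t = s - 2k + 1 and c = n - s - t. Two such host graphs differ by a shift (s + i, c - 2i, t + i);
  the candidate extremal graph belongs to the smallest admissible s, which is 2k in the first part
  and the minimum degree in the second, since an isolated vertex of G - S has all its neighbours
  in S.

  For the spectral comparison, let q be a suitable root of the characteristic cubic of the
  candidate H(s, c, t). The function that is constant on the three parts of H(s, c, t) and solves
  the eigenvalue equation at q shows that q is an eigenvalue of the candidate
  (\<open>split_join_radius_ge\<close>). For a connected spanning subgraph of any host graph the
  analogous positive function f satisfies Q f \<le> q f, with strict inequality somewhere if the
  cubic of that host is positive at q, or if it vanishes there and an edge is missing; comparing
  an eigenvector with f where their quotient is extreme gives that every eigenvalue is less than q
  (\<open>eigenvalue_less_of_supersolution\<close>).

  It remains to see that for i \<ge> 1 the cubic of the shifted host is positive at q. Its value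
  is i times a quadratic polynomial in i that decreases on i \<ge> 0
  (\<open>join_cubic_pos_antimono\<close>). Hence only the largest shift matters, i = c/2, where
  the clique K_c has disappeared and the cubic factors. For c \<ge> 6 and t = 1, and under the
  hypothesis n \<ge> 6.5 \<delta> of the second part, the relevant factor is positive; in the case
  c = 5, t = 1 the largest integral shift is i = 2, and that value is computed directly.
\<close>

section \<open>The characteristic cubic of a split join\<close>

text \<open>
  The partition of H(s, c, t) = K_s \<or> (K_c \<union> t K_1) into its three parts is equitable,
  and this is the characteristic polynomial det(q - B) of the 3 \<times> 3 quotient matrix B of
  the signless Laplacian. The parameters are real so that they can be shifted by half-integers.
\<close>

definition join_cubic :: "real \<Rightarrow> real \<Rightarrow> real \<Rightarrow> real \<Rightarrow> real" where
  "join_cubic s c t q =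
     (q - 2 * s - c - t + 2) * (q - s - 2 * c + 2) * (q - s)
       - c * s * (q - s) - t * s * (q - s - 2 * c + 2)"

text \<open>
  The natural variable is the excess e of q over 2(s + c - 1), the signless Laplacian radius of
  the clique K_{s+c} contained in H(s, c, t).
\<close>

lemma join_cubic_shift:
  "join_cubic s c t (2 * (s + c - 1) + e) =
     (s + 2 * c - 2 + e) * (e * (s + c - t + e) - t * s) - t * s * (s + e)"
  unfolding join_cubic_def by (simp add: algebra_simps)

text \<open>
  The bound e \<ge> ts/(s + c) is the one that the Rayleigh quotient of the indicator function of
  K_{s+c} gives for the radius. Here it comes for free from the intermediate value theorem,
  because the cubic is nonpositive at e = ts/(s + c).
\<close>

lemma join_cubic_root_exists:
  assumes "s \<ge> 1" "c \<ge> 1" "t \<ge> 1"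
  obtains e where "e > 0" "e * (s + c) \<ge> t * s" "join_cubic s c t (2 * (s + c - 1) + e) = 0"
proof -
  define g where "g e = (s + 2 * c - 2 + e) * (e * (s + c - t + e) - t * s) - t * s * (s + e)"
    for e
  define l where "l = t * s / (s + c)"
  have l: "l * (s + c) = t * s" using assms by (simp add: l_def)
  have l0: "l > 0" using assms by (simp add: l_def)
  have lt: "l \<le> t" using assms by (simp add: l_def field_simps)
  have "g l = (s + 2 * c - 2 + l) * (l * (l - t)) - t * s * (s + l)"
    unfolding g_def l[symmetric] by (simp add: algebra_simps)
  moreover have "(s + 2 * c - 2 + l) * (l * (l - t)) \<le> 0"
    using assms l0 lt by (intro mult_nonneg_nonpos) auto
  moreover have "t * s * (s + l) \<ge> 0" using assms l0 by auto
  ultimately have lo: "g l \<le> 0" by linarith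
  have "t * (s * (2 * s + t)) \<le> (2 * s + t + 2 * (c - 1)) * (s * (2 * s + t) + c * (s + t))"
    using assms by (intro mult_mono) auto
  moreover have "g (s + t) = (2 * s + t + 2 * (c - 1)) * (s * (2 * s + t) + c * (s + t))
      - t * (s * (2 * s + t))"
    unfolding g_def by (simp add: algebra_simps)
  ultimately have hi: "0 \<le> g (s + t)" by linarith
  have "l \<le> s + t" using lt assms by linarith
  moreover have "continuous_on {l..s + t} g"
    unfolding g_def by (intro continuous_intros)
  ultimately obtain e where e: "l \<le> e" "g e = 0"
    using IVT'[of g l 0 "s + t"] lo hi by blast
  show ?thesis
  proof
    show "e > 0" using e l0 by linarith
    have "l * (s + c) \<le> e * (s + c)" using e assms by (intro mult_right_mono) auto
    then show "e * (s + c) \<ge> t * s" by (simp add: l)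
    show "join_cubic s c t (2 * (s + c - 1) + e) = 0"
      using e(2) unfolding join_cubic_shift g_def .
  qed
qed

text \<open>
  The left-hand side vanishes at i = 0, so a factor i can be taken out. Among the remaining terms
  those containing i have negative coefficients.
\<close>

lemma join_cubic_quotient:
  fixes s c t e i :: real
  assumes "join_cubic s c t (2 * (s + c - 1) + e) = 0"
  shows "join_cubic (s + i) (c - 2 * i) (t + i) (2 * (s + c - 1) + e) =
    i * ((s + 2 * c - 2 + e) * (s + 2 * c - 3 * t + 2 * e) - (e * (s + c - t + e) - t * s)
          - (s + t) * (s + e) - 3 * t * s - i * (6 * s + 4 * c + 4 * e - 2) - 2 * i\<^sup>2)"
proof -
  have "join_cubic (s + i) (c - 2 * i) (t + i) q = join_cubic s c t q +
    i * ((s + 2 * c - 2 + e) * (s + 2 * c - 3 * t + 2 * e) - (e * (s + c - t + e) - t * s)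
          - (s + t) * (s + e) - 3 * t * s - i * (6 * s + 4 * c + 4 * e - 2) - 2 * i\<^sup>2)"
    if "q = 2 * (s + c - 1) + e" for q
    unfolding that join_cubic_def power2_eq_square by (simp add: algebra_simps)
  then show ?thesis using assms by simp
qed

text \<open>
  The second factor in the previous lemma decreases in i \<ge> 0, so that its positivity is
  inherited by all smaller shifts.
\<close>

lemma join_cubic_pos_antimono:
  fixes s c t e i j :: real
  assumes root: "join_cubic s c t (2 * (s + c - 1) + e) = 0"
    and "s \<ge> 1" "c \<ge> 0" "e > 0" "0 < i" "i \<le> j"
    and pos: "join_cubic (s + j) (c - 2 * j) (t + j) (2 * (s + c - 1) + e) > 0"
  shows "join_cubic (s + i) (c - 2 * i) (t + i) (2 * (s + c - 1) + e) > 0"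
proof -
  have "i * (6 * s + 4 * c + 4 * e - 2) \<le> j * (6 * s + 4 * c + 4 * e - 2)"
    using assms by (intro mult_right_mono) auto
  moreover have "i\<^sup>2 \<le> j\<^sup>2" using assms by (intro power_mono) auto
  ultimately show ?thesis
    using pos assms(5,6) unfolding join_cubic_quotient[OF root] zero_less_mult_iff by linarith
qed

text \<open>
  At the shift i = c/2 the clique part is empty, so the host graph is K_{s'} \<or> t' K_1, and the
  factor belonging to the clique part splits off.
\<close>

lemma join_cubic_at_end:
  fixes s c t e :: real
  shows "join_cubic (s + c / 2) (c - 2 * (c / 2)) (t + c / 2) (2 * (s + c - 1) + e) =
    (s + e + 3 * c / 2) *
      ((c / 2 - t + e) * (s + 3 * c / 2 - 2 + e) - (t + c / 2) * (s + c / 2))"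
  unfolding join_cubic_def by (simp add: field_simps)

text \<open>
  Modulo the equation for e, the quadratic factor at i = c/2 is a positive multiple of (c - 4)e +
  s(c - 6) + c(c - 6) + 4. For c = 6 this is just 2e + 4: removing a star K_{1,6} or a K_4 from
  K_n costs the same number of edges, and the two radii differ only in a lower order term.
\<close>

lemma join_cubic_pos_one_isolated:
  fixes s c e i :: real
  assumes root: "join_cubic s c 1 (2 * (s + c - 1) + e) = 0"
    and "s \<ge> 1" "c \<ge> 6" "e > 0" "0 < i" "i \<le> c / 2"
  shows "join_cubic (s + i) (c - 2 * i) (1 + i) (2 * (s + c - 1) + e) > 0"
proof (rule join_cubic_pos_antimono[OF root _ _ _ _ \<open>i \<le> c / 2\<close>])
  define E where "E = (c / 2 - 1 + e) * (s + 3 * c / 2 - 2 + e) - (1 + c / 2) * (s + c / 2)"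
  have "(s + c + e) * E = c / 2 * ((c - 4) * e + s * (c - 6) + (c * (c - 6) + 4))
      + join_cubic s c 1 (2 * (s + c - 1) + e)"
    unfolding join_cubic_def E_def by (simp add: field_simps)
  then have "(s + c + e) * E = c / 2 * ((c - 4) * e + s * (c - 6) + (c * (c - 6) + 4))"
    using root by simp
  moreover have "(c - 4) * e > 0" "s * (c - 6) \<ge> 0" "c * (c - 6) \<ge> 0"
    using assms by (auto intro: mult_nonneg_nonneg)
  ultimately have "(s + c + e) * E > 0"
    using assms(3) mult_pos_pos[of "c / 2" "(c - 4) * e + s * (c - 6) + (c * (c - 6) + 4)"]
    by linarith
  then have "E > 0" using assms by (simp add: zero_less_mult_iff)
  then show "join_cubic (s + c / 2) (c - 2 * (c / 2)) (1 + c / 2) (2 * (s + c - 1) + e) > 0"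
    using assms unfolding join_cubic_at_end E_def by (intro mult_pos_pos) auto
qed (use assms in auto)

text \<open>
  For c = 5 positivity may fail at i = 5/2, but the number of vertices forces the integral shift
  to be at most 2.
\<close>

lemma join_cubic_pos_one_isolated_five:
  fixes s e i :: real
  assumes root: "join_cubic s 5 1 (2 * (s + 5 - 1) + e) = 0"
    and "s \<ge> 1" "e > 0" "0 < i" "i \<le> 2"
  shows "join_cubic (s + i) (5 - 2 * i) (1 + i) (2 * (s + 5 - 1) + e) > 0"
proof (rule join_cubic_pos_antimono[OF root _ _ _ _ \<open>i \<le> 2\<close>])
  have "join_cubic (s + 2) (5 - 2 * 2) (1 + 2) (2 * (s + 5 - 1) + e)
      = 2 * (e * s + 10 * e + e\<^sup>2 + 12)"
    unfolding join_cubic_quotient[OF root] power2_eq_square by (simp add: algebra_simps)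
  moreover have "e * s > 0" "e\<^sup>2 > 0" using assms by auto
  ultimately show "join_cubic (s + 2) (5 - 2 * 2) (1 + 2) (2 * (s + 5 - 1) + e) > 0"
    using assms by (smt (verit))
qed (use assms in auto)

text \<open>
  The assumption on c says that n = s + c + t is at least 6.5 s. The bound on e matters: for large
  s, with t = s - 1 and n close to 6.5 s, the quadratic factor at i = c/2 is negative when e is
  close to 0.
\<close>

lemma join_cubic_pos_few_isolated:
  fixes s c t e i :: real
  assumes root: "join_cubic s c t (2 * (s + c - 1) + e) = 0"
    and "t \<ge> 1" "t \<le> s - 1" "c \<ge> 5.5 * s - t" "e > 0" "e * (s + c) \<ge> t * s" "0 < i" "i \<le> c / 2"
  shows "join_cubic (s + i) (c - 2 * i) (t + i) (2 * (s + c - 1) + e) > 0"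
proof (rule join_cubic_pos_antimono[OF root _ _ _ _ \<open>i \<le> c / 2\<close>])
  \<comment> \<open>In terms of s, u and z the constraints say s, u \<ge> 1 and z \<ge> 0, and the part of the
    quadratic factor that is free of e is visibly positive once ts has been taken from e(s + c).\<close>
  define u where "u = s - t"
  define z where "z = c - (5.5 * s - t)"
  have uz: "u \<ge> 1" "z \<ge> 0" using assms by (auto simp: u_def z_def)
  have t: "t = s - u" and c: "c = 4.5 * s + u + z" by (auto simp: u_def z_def)
  have "(c / 2 - t + e) * (s + 3 * c / 2 - 2 + e) - (t + c / 2) * (s + c / 2)
    = c\<^sup>2 / 2 - 2 * t * c - t * s - c + 2 * t + (e * (s + c) - t * s) + e * (c - t - 2) + e * e"
    by (simp add: field_simps power2_eq_square)
  moreover have "c\<^sup>2 / 2 - 2 * t * c - t * s - c + 2 * t =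
     s\<^sup>2 / 8 + (25 / 2 * (s * u) - 5 / 2 * s - 3 * u) + 5 / 2 * u\<^sup>2
       + z * (5 / 2 * s - 1 + 3 * u + z / 2)"
    unfolding t c by (simp add: field_simps power2_eq_square)
  moreover have "s * u \<ge> s" "s * u \<ge> u" "s \<ge> 1"
    using assms(2,3) uz by (simp_all add: mult_le_cancel_left1 mult_le_cancel_right1)
  moreover have "z * (5 / 2 * s - 1 + 3 * u + z / 2) \<ge> 0"
    using assms uz by (intro mult_nonneg_nonneg) auto
  moreover have "u\<^sup>2 \<ge> 0" "s\<^sup>2 \<ge> 0" by auto
  moreover have "e * (c - t - 2) \<ge> 0" "e * e > 0" using assms by auto
  ultimately have "(c / 2 - t + e) * (s + 3 * c / 2 - 2 + e) - (t + c / 2) * (s + c / 2) > 0"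
    using assms by linarith
  then show "join_cubic (s + c / 2) (c - 2 * (c / 2)) (t + c / 2) (2 * (s + c - 1) + e) > 0"
    using assms unfolding join_cubic_at_end by (intro mult_pos_pos) auto
qed (use assms in auto)

section \<open>Neighbourhoods and the signless Laplacian\<close>

definition neighbours :: "'a pair_pre_digraph \<Rightarrow> 'a \<Rightarrow> 'a set" where
  "neighbours G v = {u \<in> pverts G. (v, u) \<in> parcs G}"

context pair_graph begin

lemma finite_neighbours: "finite (neighbours G v)"
  using pair_finite_verts by (simp add: neighbours_def)

lemma neighbours_subset: "neighbours G v \<subseteq> pverts G"
  by (auto simp: neighbours_def)

lemma mem_neighbours_iff: "u \<in> neighbours G v \<longleftrightarrow> (v, u) \<in> parcs G"
  using wellformed' by (auto simp: neighbours_def)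

lemma parcs_sym: "(u, v) \<in> parcs G \<Longrightarrow> (v, u) \<in> parcs G"
  using pair_sym_arcs by (auto simp: symmetric_def dest: symD)

lemma neighbours_sym: "u \<in> neighbours G v \<longleftrightarrow> v \<in> neighbours G u"
  by (auto simp: mem_neighbours_iff intro: parcs_sym)

lemma not_self_neighbour: "v \<notin> neighbours G v"
  using pair_no_loops by (fastforce simp: mem_neighbours_iff)

lemma edge_mem_iff: "{u, v} \<in> ugraph_edges G \<longleftrightarrow> (u, v) \<in> parcs G"
  by (auto simp: ugraph_edges_def doubleton_eq_iff intro: parcs_sym)

lemma incident_edges_eq: "incident_edges G v = (\<lambda>u. {v, u}) ` neighbours G v"
proof -
  have "e \<in> (\<lambda>u. {v, u}) ` neighbours G v" if "e \<in> incident_edges G v" for e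
  proof -
    from that obtain a b where "e = {a, b}" "(a, b) \<in> parcs G" "v = a \<or> v = b"
      by (auto simp: incident_edges_def ugraph_edges_def)
    then show ?thesis
      using parcs_sym by (auto simp: mem_neighbours_iff insert_commute)
  qed
  then show ?thesis
    by (auto simp: incident_edges_def mem_neighbours_iff edge_mem_iff)
qed

lemma inj_on_doubleton: "inj_on (\<lambda>u. {v, u}) A"
  by (auto simp: inj_on_def doubleton_eq_iff)

lemma sum_incident_edges: "(\<Sum>e\<in>incident_edges G v. h e) = (\<Sum>u\<in>neighbours G v. h {v, u})"
  by (simp add: incident_edges_eq sum.reindex[OF inj_on_doubleton])

lemma vertex_degree_eq: "vertex_degree G v = card (neighbours G v)"
  by (simp add: vertex_degree_def incident_edges_eq card_image[OF inj_on_doubleton])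

lemma eigenvalue_iff:
  "eigenvalue (signless_laplacian G (vertex_enum G)) x \<longleftrightarrow>
    (\<exists>f. (\<exists>v \<in> pverts G. f v \<noteq> 0) \<and>
      (\<forall>v \<in> pverts G. (\<Sum>u \<in> neighbours G v. f v + f u) = x * f v))"
  unfolding eigenvalue_signless_laplacian_iff[OF vertex_enum[OF pair_finite_verts]]
  by (simp add: vertex_degree_eq sum.distrib flip: neighbours_def)

lemma connected_closed_eq:
  assumes con: "Digraph_Component.connected (with_proj G)"
    and A: "A \<subseteq> pverts G" "A \<noteq> {}" "\<And>v. v \<in> A \<Longrightarrow> neighbours G v \<subseteq> A"
  shows "A = pverts G"
proof -
  obtain a where a: "a \<in> A" using A by blast
  have "v \<in> A" if v: "v \<in> pverts G" for v
  proof -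
    have "a \<rightarrow>\<^sup>*\<^bsub>mk_symmetric (with_proj G)\<^esub> v"
      using con a v A(1) by (auto simp: connected_def strongly_connected_def)
    then have "a \<rightarrow>\<^sup>*\<^bsub>with_proj G\<^esub> v"
      using reachable_mk_symmetric_eq[OF pair_sym_arcs] by simp
    then show ?thesis
    proof (induction rule: reachable_induct)
      case base
      then show ?case using a by simp
    next
      case (step x y)
      then show ?case using A(3)[of x] by (auto simp: mem_neighbours_iff)
    qed
  qed
  then show ?thesis using A(1) by blast
qed

text \<open>
  A Collatz--Wielandt bound. Let g be an eigenvector with eigenvalue x \<ge> q and let m be the
  maximum of |g|/f. At a vertex where the maximum is attained, the eigenvalue equation for g and
  the inequality for f are both tight, so the maximum is attained at all neighbours too. By
  connectedness it is attained everywhere, and then the inequality for f is nowhere strict.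
\<close>

lemma eigenvalue_less_of_supersolution:
  fixes f :: "'a \<Rightarrow> real"
  assumes con: "Digraph_Component.connected (with_proj G)"
    and pos: "\<And>v. v \<in> pverts G \<Longrightarrow> f v > 0"
    and le: "\<And>v. v \<in> pverts G \<Longrightarrow> (\<Sum>u\<in>neighbours G v. f v + f u) \<le> q * f v"
    and w: "w \<in> pverts G" "(\<Sum>u\<in>neighbours G w. f w + f u) < q * f w"
    and ev: "eigenvalue (signless_laplacian G (vertex_enum G)) x"
  shows "x < q"
proof (rule ccontr)
  assume "\<not> x < q"
  from ev obtain g where g0: "\<exists>v\<in>pverts G. g v \<noteq> 0"
    and g: "\<And>v. v \<in> pverts G \<Longrightarrow> (\<Sum>u\<in>neighbours G v. g v + g u) = x * g v"
    unfolding eigenvalue_iff by blast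
  define m where "m = Max ((\<lambda>v. \<bar>g v\<bar> / f v) ` pverts G)"
  define A where "A = {v \<in> pverts G. \<bar>g v\<bar> = m * f v}"
  have gle: "\<bar>g v\<bar> \<le> m * f v" if "v \<in> pverts G" for v
  proof -
    have "\<bar>g v\<bar> / f v \<le> m"
      unfolding m_def using that pair_finite_verts by (intro Max_ge) auto
    then show ?thesis using pos[OF that] by (simp add: field_simps)
  qed
  obtain z where "z \<in> pverts G" "g z \<noteq> 0" using g0 by blast
  then have "0 < m * f z" using gle[of z] by auto
  then have m: "m > 0" using pos[OF \<open>z \<in> pverts G\<close>] by (simp add: zero_less_mult_iff)
  have "m \<in> (\<lambda>v. \<bar>g v\<bar> / f v) ` pverts G"
    unfolding m_def using pair_finite_verts w(1) by (intro Max_in) auto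
  then obtain y where "y \<in> pverts G" "m = \<bar>g y\<bar> / f y" by blast
  then have "A \<noteq> {}" using pos[of y] by (auto simp: A_def)
  have tight: "(\<Sum>u\<in>neighbours G v. f v + f u) = q * f v \<and> neighbours G v \<subseteq> A" if "v \<in> A" for v
  proof -
    have v: "v \<in> pverts G" "\<bar>g v\<bar> = m * f v" using that by (auto simp: A_def)
    have nb: "u \<in> pverts G" if "u \<in> neighbours G v" for u
      using that neighbours_subset by blast
    have "m * (q * f v) = q * \<bar>g v\<bar>" using v by simp
    also have "\<dots> \<le> x * \<bar>g v\<bar>"
      using \<open>\<not> x < q\<close> by (intro mult_right_mono) auto
    also have "\<dots> \<le> \<bar>x * g v\<bar>" by (simp add: abs_mult mult_right_mono)
    also have "\<dots> = \<bar>\<Sum>u\<in>neighbours G v. g v + g u\<bar>" using g[OF v(1)] by simp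
    also have "\<dots> \<le> (\<Sum>u\<in>neighbours G v. \<bar>g v\<bar> + \<bar>g u\<bar>)"
      by (intro order_trans[OF sum_abs] sum_mono abs_triangle_ineq)
    finally have 1: "m * (q * f v) \<le> (\<Sum>u\<in>neighbours G v. \<bar>g v\<bar> + \<bar>g u\<bar>)" .
    have 2: "(\<Sum>u\<in>neighbours G v. \<bar>g v\<bar> + \<bar>g u\<bar>) \<le> (\<Sum>u\<in>neighbours G v. m * f v + m * f u)"
      using v gle nb by (intro sum_mono) auto
    have 3: "(\<Sum>u\<in>neighbours G v. m * f v + m * f u) = m * (\<Sum>u\<in>neighbours G v. f v + f u)"
      by (simp add: sum_distrib_left distrib_left)
    have 4: "m * (\<Sum>u\<in>neighbours G v. f v + f u) \<le> m * (q * f v)"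
      using le[OF v(1)] m by (intro mult_left_mono) auto
    have eq: "m * (\<Sum>u\<in>neighbours G v. f v + f u) = m * (q * f v)"
      using 1 2 3 4 by linarith
    have "\<bar>g u\<bar> = m * f u" if u: "u \<in> neighbours G v" for u
    proof (rule ccontr)
      assume "\<bar>g u\<bar> \<noteq> m * f u"
      then have "(\<Sum>u\<in>neighbours G v. \<bar>g v\<bar> + \<bar>g u\<bar>) < (\<Sum>u\<in>neighbours G v. m * f v + m * f u)"
        using v gle nb u
        by (intro sum_strict_mono_ex1[OF finite_neighbours]) (auto simp: less_le)
      then show False using 1 3 eq by linarith
    qed
    then show ?thesis using eq m nb by (auto simp: A_def)
  qed
  have "A = pverts G"
    using \<open>A \<noteq> {}\<close> tight by (intro connected_closed_eq[OF con]) (auto simp: A_def)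
  then show False using tight[of w] w by simp
qed

end

text \<open>
  A complex eigenvalue l of A exists since the characteristic polynomial has a root. If f and g
  are the real and imaginary parts of an eigenvector, then evaluating \<open>g\<^sup>T A f =
  f\<^sup>T A g\<close> on both sides gives Im(l) (|f|^2 + |g|^2) = 0, so l is real and f or g is
  a real eigenvector.
\<close>

lemma symmetric_real_mat_has_eigenvalue:
  fixes A :: "real mat"
  assumes A: "A \<in> carrier_mat n n" and n: "n > 0"
    and sym: "\<And>i j. i < n \<Longrightarrow> j < n \<Longrightarrow> A $$ (i, j) = A $$ (j, i)"
  shows "\<exists>x. eigenvalue A x"
proof -
  let ?A = "map_mat complex_of_real A"
  have cA: "?A \<in> carrier_mat n n" using A by simp
  obtain l where "eigenvalue ?A l"
    using spectrum_non_empty[OF cA n] by (auto simp: spectrum_def)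
  then obtain v where v: "v \<in> carrier_vec n" "v \<noteq> 0\<^sub>v n" "?A *\<^sub>v v = l \<cdot>\<^sub>v v"
    using A by (auto simp: eigenvalue_def eigenvector_def)
  define f g where "f i = Re (v $ i)" and "g i = Im (v $ i)" for i
  have ev: "(\<Sum>j<n. complex_of_real (A $$ (i, j)) * v $ j) = l * v $ i" if "i < n" for i
  proof -
    have "(?A *\<^sub>v v) $ i = (l \<cdot>\<^sub>v v) $ i" by (simp add: v(3))
    then show ?thesis using that v(1) A by (simp add: scalar_prod_def atLeast0LessThan)
  qed
  have re: "(\<Sum>j<n. A $$ (i, j) * f j) = Re l * f i - Im l * g i" if "i < n" for i
    using arg_cong[OF ev[OF that], of Re] by (simp add: f_def g_def)
  have im: "(\<Sum>j<n. A $$ (i, j) * g j) = Re l * g i + Im l * f i" if "i < n" for i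
    using arg_cong[OF ev[OF that], of Im] by (simp add: f_def g_def)
  have "(\<Sum>i<n. g i * (\<Sum>j<n. A $$ (i, j) * f j)) = (\<Sum>i<n. \<Sum>j<n. g i * A $$ (i, j) * f j)"
    by (simp add: sum_distrib_left mult.assoc)
  also have "\<dots> = (\<Sum>j<n. \<Sum>i<n. g i * A $$ (i, j) * f j)" by (rule sum.swap)
  also have "\<dots> = (\<Sum>j<n. f j * (\<Sum>i<n. A $$ (j, i) * g i))"
    unfolding sum_distrib_left by (intro sum.cong refl) (simp add: sym)
  finally have "(\<Sum>i<n. g i * (Re l * f i - Im l * g i)) = (\<Sum>i<n. f i * (Re l * g i + Im l * f i))"
    using re im by simp
  then have "Im l * (\<Sum>i<n. (f i)\<^sup>2 + (g i)\<^sup>2) = 0"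
    by (simp add: sum_distrib_left algebra_simps sum.distrib sum_subtractf power2_eq_square)
  moreover obtain i where nz: "i < n" "f i \<noteq> 0 \<or> g i \<noteq> 0"
    using v(1,2) by (auto simp: vec_eq_iff f_def g_def complex_eq_iff)
  then have "(\<Sum>i<n. (f i)\<^sup>2 + (g i)\<^sup>2) > 0"
    by (intro sum_pos2[of _ i]) (auto simp: sum_power2_gt_zero_iff)
  ultimately have l0: "Im l = 0" by simp
  have "eigenvalue A (Re l)" if h: "\<And>i. i < n \<Longrightarrow> (\<Sum>j<n. A $$ (i, j) * h j) = Re l * h i"
    and "\<exists>i<n. h i \<noteq> 0" for h
  proof -
    have "A *\<^sub>v vec n h = Re l \<cdot>\<^sub>v vec n h"
      using A h by (auto simp: vec_eq_iff scalar_prod_def atLeast0LessThan)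
    moreover have "vec n h \<noteq> 0\<^sub>v n" using that(2) by (auto simp: vec_eq_iff)
    ultimately show ?thesis
      using A by (auto simp: eigenvalue_def eigenvector_def intro!: exI[of _ "vec n h"])
  qed
  from this[of f] this[of g] show ?thesis using nz re im l0 by auto
qed

context pair_graph begin

text \<open>
  The radius is defined as the maximum of the set of eigenvalues; that set is finite and, by the
  previous lemma, nonempty, so the maximum is attained.
\<close>

lemma signless_laplacian_radius_eigenvalue:
  assumes "pverts G \<noteq> {}"
  shows "eigenvalue (signless_laplacian G (vertex_enum G)) (signless_laplacian_radius G)"
    and "eigenvalue (signless_laplacian G (vertex_enum G)) x \<Longrightarrow> x \<le> signless_laplacian_radius G"
proof -
  let ?Q = "signless_laplacian G (vertex_enum G)" and ?n = "length (vertex_enum G)"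
  have Q: "?Q \<in> carrier_mat ?n ?n"
    by (auto simp: signless_laplacian_def degree_matrix_def adjacency_matrix_def)
  have fin: "finite {x. eigenvalue ?Q x}"
    using card_finite_spectrum(1)[OF Q] by (simp add: spectrum_def)
  have "?n > 0" using assms vertex_enum(2)[OF pair_finite_verts] by fastforce
  moreover have "?Q $$ (i, j) = ?Q $$ (j, i)" if "i < ?n" "j < ?n" for i j
    using that parcs_sym
    by (auto simp: signless_laplacian_def degree_matrix_def adjacency_matrix_def)
  ultimately have "\<exists>x. eigenvalue ?Q x" by (rule symmetric_real_mat_has_eigenvalue[OF Q])
  then have "{x. eigenvalue ?Q x} \<noteq> {}" by blast
  from Max_in[OF fin this] show "eigenvalue ?Q (signless_laplacian_radius G)"
    by (simp add: signless_laplacian_radius_def)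
  show "x \<le> signless_laplacian_radius G" if "eigenvalue ?Q x"
    unfolding signless_laplacian_radius_def using fin that by (intro Max_ge) auto
qed

end

section \<open>Barriers to fractional extendability\<close>

text \<open>
  Hall's marriage theorem, by the induction of Halmos and Vaughan: either a proper nonempty subset
  meets its bound with equality, and the problem splits into this subset and its complement, or
  there is slack everywhere and one element may be matched arbitrarily.
\<close>

lemma hall_marriage:
  fixes N :: "'a \<Rightarrow> 'b set"
  assumes "finite V" "\<And>v. v \<in> V \<Longrightarrow> finite (N v)"
    and "\<And>X. X \<subseteq> V \<Longrightarrow> card X \<le> card (\<Union>(N ` X))"
  shows "\<exists>\<phi>. inj_on \<phi> V \<and> (\<forall>v\<in>V. \<phi> v \<in> N v)"
  using assms
proof (induction "card V" arbitrary: V N rule: less_induct)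
  case less
  note fin = less.prems(1,2) and hall = less.prems(3)
  show ?case
  proof (cases "\<exists>X. X \<subset> V \<and> X \<noteq> {} \<and> card (\<Union>(N ` X)) = card X")
    case True
    then obtain X where X: "X \<subset> V" "X \<noteq> {}" "card (\<Union>(N ` X)) = card X" by blast
    let ?U = "\<Union>(N ` X)"
    have "\<exists>f. inj_on f X \<and> (\<forall>v\<in>X. f v \<in> N v)"
    proof (rule less.hyps)
      show "card X < card V" using X fin by (simp add: psubset_card_mono)
      show "finite X" using X fin by (auto intro: finite_subset)
    qed (use X fin hall in auto)
    then obtain f where f: "inj_on f X" "\<And>v. v \<in> X \<Longrightarrow> f v \<in> N v" by blast
    have "\<exists>g. inj_on g (V - X) \<and> (\<forall>v\<in>V - X. g v \<in> N v - ?U)"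
    proof (rule less.hyps)
      show "card (V - X) < card V" using X fin by (intro psubset_card_mono) auto
      fix Y assume Y: "Y \<subseteq> V - X"
      have "card X + card Y = card (X \<union> Y)"
        using Y X fin by (intro card_Un_disjoint[symmetric]) (auto intro: finite_subset)
      also have "\<dots> \<le> card (\<Union>(N ` (X \<union> Y)))" using Y X by (intro hall) auto
      also have "\<Union>(N ` (X \<union> Y)) = ?U \<union> \<Union>((\<lambda>v. N v - ?U) ` Y)" by auto
      also have "card \<dots> \<le> card ?U + card (\<Union>((\<lambda>v. N v - ?U) ` Y))" by (rule card_Un_le)
      finally show "card Y \<le> card (\<Union>((\<lambda>v. N v - ?U) ` Y))" using X by simp
    qed (use fin in auto)
    then obtain g where g: "inj_on g (V - X)" "\<And>v. v \<in> V - X \<Longrightarrow> g v \<in> N v - ?U" by blast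
    let ?h = "\<lambda>v. if v \<in> X then f v else g v"
    have "f x \<noteq> g y" "g y \<noteq> f x" if "x \<in> X" "y \<in> V - X" for x y
      using f(2)[of x] g(2)[of y] that by auto
    then have "inj_on ?h (X \<union> (V - X))"
      using f(1) g(1) by (auto simp: inj_on_def)
    moreover have "X \<union> (V - X) = V" using X by blast
    moreover have "\<forall>v\<in>V. ?h v \<in> N v" using f g by auto
    ultimately show ?thesis by auto
  next
    case noX: False
    show ?thesis
    proof (cases "V = {}")
      case nonempty: False
      then obtain a where a: "a \<in> V" by blast
      have "card (N a) \<ge> 1" using hall[of "{a}"] a by auto
      then have "N a \<noteq> {}" by auto
      then obtain b where b: "b \<in> N a" by blast
      have "\<exists>f. inj_on f (V - {a}) \<and> (\<forall>v\<in>V - {a}. f v \<in> N v - {b})"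
      proof (rule less.hyps)
        show "card (V - {a}) < card V" using a fin(1) by (rule card_Diff1_less[rotated])
        fix X assume X: "X \<subseteq> V - {a}"
        show "card X \<le> card (\<Union>((\<lambda>v. N v - {b}) ` X))"
        proof (cases "X = {}")
          case False
          moreover have "X \<subset> V" using X a by blast
          ultimately have "card (\<Union>(N ` X)) \<noteq> card X" using noX by blast
          moreover have "card X \<le> card (\<Union>(N ` X))" using X by (intro hall) auto
          moreover have "\<Union>((\<lambda>v. N v - {b}) ` X) = \<Union>(N ` X) - {b}" by auto
          moreover have "card (\<Union>(N ` X)) - 1 \<le> card (\<Union>(N ` X) - {b})"
            using diff_card_le_card_Diff[of "{b}" "\<Union>(N ` X)"] by simp
          ultimately show ?thesis by simp
        qed simp
      qed (use fin in auto)
      then obtain f where f: "inj_on f (V - {a})" "\<And>v. v \<in> V - {a} \<Longrightarrow> f v \<in> N v - {b}" by blast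
      have "inj_on (f(a := b)) (insert a (V - {a}))"
        using f by (auto simp: inj_on_def)
      moreover have "\<forall>v\<in>V. (f(a := b)) v \<in> N v" using f b by auto
      ultimately show ?thesis using a by (metis insert_Diff)
    qed auto
  qed
qed

context pair_graph begin

text \<open>
  A permutation that moves every vertex to a neighbour decomposes the graph into edges and
  directed cycles. Giving half a unit to the edge from w to \<phi>(w) for each vertex w adds up to
  one at every vertex, half from the arc leaving it and half from the arc entering it; an edge
  whose ends are swapped gets the full weight 1.
\<close>

lemma fractional_perfect_matching_of_permutation:
  assumes bij: "bij_betw \<phi> (pverts G) (pverts G)"
    and adj: "\<And>v. v \<in> pverts G \<Longrightarrow> (v, \<phi> v) \<in> parcs G"
  shows "fractional_perfect_matching G (\<lambda>e. real (card {w \<in> e. \<phi> w \<in> e}) / 2)"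
  unfolding fractional_perfect_matching_def
proof (intro conjI ballI)
  fix e assume "e \<in> ugraph_edges G"
  then obtain a b where e: "e = {a, b}" by (auto simp: ugraph_edges_def)
  have "card {w \<in> e. \<phi> w \<in> e} \<le> card e" by (intro card_mono) (auto simp: e)
  also have "\<dots> \<le> 2" by (simp add: e card_insert_if)
  finally show "real (card {w \<in> e. \<phi> w \<in> e}) / 2 \<le> 1" by simp
next
  fix v assume v: "v \<in> pverts G"
  have fix_free: "\<phi> u \<noteq> u" if "u \<in> pverts G" for u
    using adj[OF that] pair_no_loops by fastforce
  have card_eq: "real (card {w \<in> {v, u}. \<phi> w \<in> {v, u}}) = of_bool (\<phi> v = u) + of_bool (\<phi> u = v)"
    if "u \<in> neighbours G v" for u
  proof -
    have "u \<in> pverts G" "u \<noteq> v" using that neighbours_subset not_self_neighbour by auto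
    then have "{w \<in> {v, u}. \<phi> w \<in> {v, u}} =
        (if \<phi> v = u then {v} else {}) \<union> (if \<phi> u = v then {u} else {})"
      using fix_free[OF v] fix_free[of u] by auto
    then show ?thesis using \<open>u \<noteq> v\<close> by simp
  qed
  have "v \<in> \<phi> ` pverts G" using v bij_betw_imp_surj_on[OF bij] by simp
  then obtain z where z: "z \<in> pverts G" "\<phi> z = v" by (elim imageE) simp
  have out: "neighbours G v \<inter> {u. \<phi> v = u} = {\<phi> v}"
    using adj[OF v] by (auto simp: mem_neighbours_iff)
  have inn: "neighbours G v \<inter> {u. \<phi> u = v} = {z}"
  proof -
    have "z \<in> neighbours G v" using adj[OF z(1)] z(2) parcs_sym by (auto simp: mem_neighbours_iff)
    moreover have "u = z" if u: "u \<in> neighbours G v" "\<phi> u = v" for u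
    proof (rule inj_onD[OF bij_betw_imp_inj_on[OF bij]])
      show "u \<in> pverts G" using u(1) neighbours_subset by blast
    qed (use u z in auto)
    ultimately show ?thesis using z(2) by blast
  qed
  have "(\<Sum>u\<in>neighbours G v. real (card {w \<in> {v, u}. \<phi> w \<in> {v, u}}) / 2)
      = (\<Sum>u\<in>neighbours G v. of_bool (\<phi> v = u) + of_bool (\<phi> u = v)) / 2"
    unfolding sum_divide_distrib by (intro sum.cong refl) (simp only: card_eq)
  also have "\<dots> = 1"
  proof -
    have "(\<Sum>u\<in>neighbours G v. of_bool (\<phi> v = u)) = (1 :: real)"
      by (subst sum_of_bool_eq) (simp_all only: finite_neighbours out, simp)
    moreover have "(\<Sum>u\<in>neighbours G v. of_bool (\<phi> u = v)) = (1 :: real)"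
      by (subst sum_of_bool_eq) (simp_all only: finite_neighbours inn, simp)
    ultimately show ?thesis by (simp add: sum.distrib)
  qed
  finally show "(\<Sum>e\<in>incident_edges G v. real (card {w \<in> e. \<phi> w \<in> e}) / 2) = 1"
    by (simp add: sum_incident_edges)
qed auto

lemma ugraph_edge:
  assumes "e \<in> ugraph_edges G"
  shows "card e = 2" "e \<subseteq> pverts G"
proof -
  obtain a b where ab: "e = {a, b}" "(a, b) \<in> parcs G"
    using assms by (auto simp: ugraph_edges_def)
  have "a \<noteq> b" using pair_no_loops[OF ab(2)] by simp
  then show "card e = 2" by (simp add: ab(1))
  show "e \<subseteq> pverts G" using wellformed'[OF ab(2)] by (simp add: ab(1))
qed

lemma is_matching_verts:
  assumes "is_matching G k M"
  shows "card (\<Union>M) = 2 * k" "\<Union>M \<subseteq> pverts G"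
proof -
  have edge: "card e = 2 \<and> e \<subseteq> pverts G" if "e \<in> M" for e
    using that assms ugraph_edge by (auto simp: is_matching_def)
  have "card (\<Union>M) = sum card M"
    using assms edge by (intro card_Union_disjoint) (auto simp: is_matching_def intro: card_ge_0_finite)
  then show "card (\<Union>M) = 2 * k" using assms edge by (simp add: is_matching_def)
  show "\<Union>M \<subseteq> pverts G" using edge by blast
qed

text \<open>
  Swapping the ends of each edge of M and using Hall's theorem on the remaining vertices gives a
  permutation as in the previous lemma, and the edges of M get weight 1.
\<close>

lemma matching_extends_if_hall:
  assumes M: "is_matching G k M"
    and W: "W = pverts G - \<Union>M"
    and hallc: "\<And>X. X \<subseteq> W \<Longrightarrow> card X \<le> card (\<Union>v\<in>X. neighbours G v \<inter> W)"
  shows "\<exists>h. fractional_perfect_matching G h \<and> (\<forall>e\<in>M. h e = 1)"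
proof -
  have same: "e = e'" if "e \<in> M" "e' \<in> M" "x \<in> e" "x \<in> e'" for e e' x
    using that M by (auto simp: is_matching_def pairwise_def disjnt_iff)
  have "\<exists>u. {v, u} \<in> M" if v: "v \<in> \<Union>M" for v
  proof -
    obtain e where e: "e \<in> M" "v \<in> e" using v by blast
    then obtain a b where "e = {a, b}"
      using M by (auto simp: is_matching_def ugraph_edges_def)
    with e show ?thesis by (auto simp: insert_commute)
  qed
  then obtain p where p: "\<And>v. v \<in> \<Union>M \<Longrightarrow> {v, p v} \<in> M" by metis
  obtain r where r: "inj_on r W" "\<And>v. v \<in> W \<Longrightarrow> r v \<in> neighbours G v \<inter> W"
    using hall_marriage[where V = W and N = "\<lambda>v. neighbours G v \<inter> W"] hallc W pair_finite_verts finite_neighbours by auto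
  define \<phi> where "\<phi> v = (if v \<in> \<Union>M then p v else r v)" for v
  have adj: "(v, \<phi> v) \<in> parcs G" if "v \<in> pverts G" for v
  proof (cases "v \<in> \<Union>M")
    case True
    then have "{v, p v} \<in> ugraph_edges G" using p M by (auto simp: is_matching_def)
    then show ?thesis using True by (simp add: \<phi>_def edge_mem_iff)
  next
    case False
    then show ?thesis using r(2)[of v] that W by (auto simp: \<phi>_def mem_neighbours_iff)
  qed
  have inM: "\<phi> v \<in> \<Union>M \<longleftrightarrow> v \<in> \<Union>M" if "v \<in> pverts G" for v
  proof (cases "v \<in> \<Union>M")
    case True
    then have "p v \<in> \<Union>M" using p[OF True] by blast
    then show ?thesis using True by (simp add: \<phi>_def)
  next
    case False
    then show ?thesis using r(2)[of v] that W by (simp add: \<phi>_def)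
  qed
  have "inj_on \<phi> (pverts G)"
  proof (rule inj_onI)
    fix x y assume xy: "x \<in> pverts G" "y \<in> pverts G" "\<phi> x = \<phi> y"
    show "x = y"
    proof (cases "x \<in> \<Union>M")
      case True
      then have y: "y \<in> \<Union>M" using inM xy by metis
      have "{x, p x} = {y, p x}"
        using same[OF p[OF True] p[OF y], of "p x"] xy True y by (simp add: \<phi>_def)
      then show ?thesis by (auto simp: doubleton_eq_iff)
    next
      case False
      then have "y \<notin> \<Union>M" using inM xy by metis
      then show ?thesis using False xy r(1) W by (auto simp: \<phi>_def dest: inj_onD)
    qed
  qed
  moreover have "\<phi> ` pverts G \<subseteq> pverts G" using adj in_arcsD2 by blast
  ultimately have "bij_betw \<phi> (pverts G) (pverts G)"
    using endo_inj_surj[OF pair_finite_verts] by (auto simp: bij_betw_def)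
  note fpm = fractional_perfect_matching_of_permutation[OF this adj]
  have "real (card {w \<in> e. \<phi> w \<in> e}) / 2 = 1" if e: "e \<in> M" for e
  proof -
    have "\<phi> w \<in> e" if "w \<in> e" for w
      using same[OF e p[of w] that] e that by (auto simp: \<phi>_def)
    then have "{w \<in> e. \<phi> w \<in> e} = e" by auto
    moreover have "card e = 2"
      using e M ugraph_edge(1) by (auto simp: is_matching_def)
    ultimately show ?thesis by simp
  qed
  then show ?thesis using fpm by blast
qed

text \<open>
  Without a k-matching, the vertices of a maximum matching form a vertex cover of fewer than 2k
  vertices, which can be padded to exactly 2k vertices. With a k-matching M that does not extend,
  Hall's condition fails for some set X of vertices that M does not meet. The vertices of X that
  have a neighbour in X themselves belong to the neighbourhood of X and pay for themselves; hence
  the remaining vertices of X, an independent set I, have a set B of fewer than |I| neighbours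
  outside M. Together with B, the vertices of M form the set S.
\<close>

lemma not_fractional_extendable_obtains:
  assumes n: "2 * k + 2 \<le> card (pverts G)" and not: "\<not> fractional_extendable k G"
  obtains S T where "S \<subseteq> pverts G" "T \<subseteq> pverts G - S" "2 * k \<le> card S"
    "card T = card S - 2 * k + 1" "\<And>v. v \<in> T \<Longrightarrow> neighbours G v \<subseteq> S"
proof (cases "\<exists>M. is_matching G k M")
  case False
  define Q where "Q j \<longleftrightarrow> (\<exists>M. is_matching G j M)" for j
  have "finite (ugraph_edges G)"
    by (rule finite_subset[of _ "Pow (pverts G)"])
      (use pair_finite_verts ugraph_edge(2) in auto)
  then have bound: "j \<le> card (ugraph_edges G)" if "Q j" for j
    using that card_mono by (auto simp: Q_def is_matching_def)
  have "Q 0" by (auto simp: Q_def is_matching_def)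
  define j where "j = Greatest Q"
  have "Q j" unfolding j_def using \<open>Q 0\<close> bound by (rule GreatestI_nat)
  then obtain M where M: "is_matching G j M" by (auto simp: Q_def)
  have "j < k"
  proof (rule ccontr)
    assume "\<not> j < k"
    then obtain M' where "M' \<subseteq> M" "card M' = k"
      using M obtain_subset_with_card_n[of k M] by (auto simp: is_matching_def)
    then have "is_matching G k M'"
      using M by (auto simp: is_matching_def intro: finite_subset pairwise_subset)
    then show False using False by blast
  qed
  then obtain S where S: "\<Union>M \<subseteq> S" "S \<subseteq> pverts G" "card S = 2 * k"
    using exists_subset_between[of "\<Union>M" "2 * k" "pverts G"] is_matching_verts[OF M] n pair_finite_verts
    by auto
  have "pverts G - S \<noteq> {}"
    using S n card_mono[of S "pverts G"] pair_finite_verts by (auto intro: finite_subset)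
  then obtain v where v: "v \<in> pverts G" "v \<notin> S" by blast
  have "neighbours G v \<subseteq> S"
  proof
    fix u assume u: "u \<in> neighbours G v"
    show "u \<in> S"
    proof (rule ccontr)
      assume "u \<notin> S"
      then have disj: "\<forall>e\<in>M. disjnt {v, u} e" using S v by (auto simp: disjnt_def)
      then have "{v, u} \<notin> M" by (auto simp: disjnt_def)
      then have "is_matching G (Suc j) (insert {v, u} M)"
        using M disj u by (auto simp: is_matching_def pairwise_insert edge_mem_iff mem_neighbours_iff disjnt_sym)
      then have "Q (Suc j)" by (auto simp: Q_def)
      then have "Suc j \<le> j" unfolding j_def using bound by (rule Greatest_le_nat)
      then show False by simp
    qed
  qed
  then show ?thesis using that[of S "{v}"] S v by auto
next
  case True
  then obtain M where M: "is_matching G k M"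
    and nofpm: "\<nexists>h. fractional_perfect_matching G h \<and> (\<forall>e\<in>M. h e = 1)"
    using not n by (auto simp: fractional_extendable_def)
  define W where "W = pverts G - \<Union>M"
  obtain X where X: "X \<subseteq> W" "card (\<Union>v\<in>X. neighbours G v \<inter> W) < card X"
    using matching_extends_if_hall[OF M W_def] nofpm by (meson not_le)
  define I where "I = {v \<in> X. neighbours G v \<inter> X = {}}"
  define B where "B = (\<Union>v\<in>I. neighbours G v \<inter> W)"
  have finW: "finite W" using pair_finite_verts by (simp add: W_def)
  have fin: "finite X" "finite I" "finite B"
    using finW X by (auto simp: I_def B_def intro: finite_subset)
  have "B \<union> (X - I) \<subseteq> (\<Union>v\<in>X. neighbours G v \<inter> W)"
  proof -
    have "v \<in> (\<Union>v\<in>X. neighbours G v \<inter> W)" if v: "v \<in> X - I" for v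
    proof -
      obtain u where "u \<in> X" "u \<in> neighbours G v" using v by (auto simp: I_def)
      then show ?thesis using v X neighbours_sym[of u v] by auto
    qed
    then show ?thesis by (auto simp: B_def I_def)
  qed
  then have "card (B \<union> (X - I)) \<le> card (\<Union>v\<in>X. neighbours G v \<inter> W)"
    using finW by (intro card_mono) (auto intro: finite_subset)
  moreover have "card (B \<union> (X - I)) = card B + card (X - I)"
    using fin by (intro card_Un_disjoint) (auto simp: B_def I_def)
  moreover have "card X = card I + card (X - I)"
    using fin card_Un_disjoint[of I "X - I"] by (simp add: I_def Un_absorb1)
  ultimately have "card B < card I" using X(2) by linarith
  then obtain T where T: "T \<subseteq> I" "card T = card B + 1"
    using obtain_subset_with_card_n[of "card B + 1" I] by auto
  have cardS: "card (\<Union>M \<union> B) = 2 * k + card B"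
    using is_matching_verts(1)[OF M] fin finite_subset[OF is_matching_verts(2)[OF M] pair_finite_verts]
    by (subst card_Un_disjoint) (auto simp: B_def W_def)
  show ?thesis
  proof (rule that[of "\<Union>M \<union> B" T])
    show "\<Union>M \<union> B \<subseteq> pverts G" using is_matching_verts[OF M] by (auto simp: B_def W_def)
    show "T \<subseteq> pverts G - (\<Union>M \<union> B)"
      using T X by (auto simp: I_def B_def W_def)
    show "neighbours G v \<subseteq> \<Union>M \<union> B" if "v \<in> T" for v
      using that T neighbours_subset by (auto simp: B_def W_def)
  qed (use T cardS in auto)
qed

end

section \<open>Spanning subgraphs of a split join\<close>

text \<open>
  Neighbourhoods in the copy of the graph H(s, c, t) on S \<union> C \<union> T that has its
  universal vertices in S, its further clique on C and its independent vertices in T.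
\<close>

definition join_nbhd :: "'a set \<Rightarrow> 'a set \<Rightarrow> 'a set \<Rightarrow> 'a \<Rightarrow> 'a set" where
  "join_nbhd S C T v =
     (if v \<in> S then (S - {v}) \<union> C \<union> T else if v \<in> C then S \<union> (C - {v}) else S)"

text \<open>
  With the value 1 on S, these are the values on C and T that solve the eigenvalue equation for q
  at the vertices of C and T.
\<close>

definition join_weight :: "'a set \<Rightarrow> 'a set \<Rightarrow> real \<Rightarrow> 'a \<Rightarrow> real" where
  "join_weight S C q v =
     (if v \<in> S then 1
      else if v \<in> C then real (card S) / (q - real (card S) - 2 * real (card C) + 2)
      else real (card S) / (q - real (card S)))"

text \<open>
  The equation at the vertices of S is the only one that can fail, and the characteristic cubic
  measures its defect.
\<close>

lemma signless_laplacian_join_weight: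
  fixes q :: real
  assumes fin: "finite S" "finite C" "finite T"
    and disj: "S \<inter> C = {}" "S \<inter> T = {}" "C \<inter> T = {}"
    and q: "q - card S - 2 * card C + 2 > 0" "q - card S > 0"
    and v: "v \<in> S \<union> C \<union> T"
  shows "(\<Sum>u\<in>join_nbhd S C T v. join_weight S C q v + join_weight S C q u) =
    q * join_weight S C q v
     - (if v \<in> S then join_cubic (card S) (card C) (card T) q /
          ((q - card S - 2 * card C + 2) * (q - card S)) else 0)"
proof -
  let ?f = "join_weight S C q"
  define s c t where "s = real (card S)" and "c = real (card C)" and "t = real (card T)"
  define x y where "x = s / (q - s - 2 * c + 2)" and "y = s / (q - s)"
  have nz: "q - s - 2 * c + 2 \<noteq> 0" "q - s \<noteq> 0" using q by (auto simp: s_def c_def)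
  have fS: "?f u = 1" if "u \<in> S" for u using that by (simp add: join_weight_def)
  have fC: "?f u = x" if "u \<in> C" for u
    using that disj by (auto simp: join_weight_def x_def s_def c_def)
  have fT: "?f u = y" if "u \<in> T" for u
    using that disj by (auto simp: join_weight_def y_def s_def)
  have sS: "(\<Sum>u\<in>S. a + ?f u) = s * (a + 1)" for a
    by (simp add: fS s_def)
  have sC: "(\<Sum>u\<in>C. a + ?f u) = c * (a + x)" for a
    by (simp add: fC c_def)
  have sT: "(\<Sum>u\<in>T. a + ?f u) = t * (a + y)" for a
    by (simp add: fT t_def)
  have xeq: "x * (q - s - 2 * c + 2) = s" using nz by (simp add: x_def)
  have yeq: "y * (q - s) = s" using nz by (simp add: y_def)
  have rest: "R = X - (a + y)" if "Y = a + z + R" "Y = X" "z = y" for R X Y a y z :: real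
    using that by simp
  consider "v \<in> S" | "v \<in> C" "v \<notin> S" | "v \<in> T" "v \<notin> S" "v \<notin> C" using v disj by blast
  then show ?thesis
  proof cases
    case 1
    have rS: "(\<Sum>u\<in>S - {v}. 1 + ?f u) = s * 2 - 2"
      by (rule rest[OF sum.remove[OF fin(1) 1] sS fS[OF 1], THEN trans]) simp
    have "join_nbhd S C T v = (S - {v}) \<union> (C \<union> T)" using 1 by (auto simp: join_nbhd_def)
    then have "(\<Sum>u\<in>join_nbhd S C T v. ?f v + ?f u) =
        (\<Sum>u\<in>S - {v}. 1 + ?f u) + ((\<Sum>u\<in>C. 1 + ?f u) + (\<Sum>u\<in>T. 1 + ?f u))"
      using fin disj 1
      by (simp only: fS, subst sum.union_disjoint) (auto simp only: sum.union_disjoint)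
    also have "\<dots> = s * 2 - 2 + c * (1 + x) + t * (1 + y)"
      by (simp only: rS sC sT add.assoc)
    also have "\<dots> = q - join_cubic s c t q / ((q - s - 2 * c + 2) * (q - s))"
    proof -
      have "join_cubic s c t q = (q - 2 * s - c - t + 2) * ((q - s - 2 * c + 2) * (q - s))
        - c * (x * (q - s - 2 * c + 2)) * (q - s) - t * (y * (q - s)) * (q - s - 2 * c + 2)"
        unfolding join_cubic_def xeq yeq by (simp add: mult.assoc)
      also have "\<dots> = (q - 2 * s - c - t + 2 - c * x - t * y) * ((q - s - 2 * c + 2) * (q - s))"
        by (simp add: left_diff_distrib mult_ac)
      finally have "join_cubic s c t q / ((q - s - 2 * c + 2) * (q - s))
          = q - 2 * s - c - t + 2 - c * x - t * y"
        using nz by simp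
      then show ?thesis by (simp only: distrib_left mult_1_right)
    qed
    finally show ?thesis using 1 fS by (simp add: s_def c_def t_def)
  next
    case 2
    have rC: "(\<Sum>u\<in>C - {v}. x + ?f u) = c * (x + x) - (x + x)"
      by (rule rest[OF sum.remove[OF fin(2) 2(1)] sC fC[OF 2(1)]])
    have "join_nbhd S C T v = S \<union> (C - {v})" using 2 by (simp add: join_nbhd_def)
    then have "(\<Sum>u\<in>join_nbhd S C T v. ?f v + ?f u) =
        (\<Sum>u\<in>S. x + ?f u) + (\<Sum>u\<in>C - {v}. x + ?f u)"
      using fin disj 2 by (simp only: fC, subst sum.union_disjoint) auto
    also have "\<dots> = s * (x + 1) + (c * (x + x) - (x + x))" by (simp only: sS rC)
    also have "\<dots> = q * x" using xeq by (simp add: algebra_simps)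
    finally show ?thesis using 2 fC by simp
  next
    case 3
    have "(\<Sum>u\<in>join_nbhd S C T v. ?f v + ?f u) = s * (y + 1)"
      using 3 sS[of y] by (simp add: join_nbhd_def fT)
    also have "\<dots> = q * y" using yeq by (simp add: algebra_simps)
    finally show ?thesis using 3 fT by simp
  qed
qed

text \<open>
  The graph H(s, c, t), in the same form as the extremal graphs of the theorem.
\<close>

definition split_join :: "nat \<Rightarrow> nat \<Rightarrow> nat \<Rightarrow> (nat + nat + nat) pair_pre_digraph" where
  "split_join s c t =
     graph_join (complete_ugraph s) (disjoint_union (complete_ugraph c) (edgeless_ugraph t))"

lemma pair_graph_split_join: "pair_graph (split_join s c t)"
  unfolding split_join_def
  by (intro pair_graph_graph_join pair_graph_disjoint_union pair_graph_complete_ugraph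
      pair_graph_edgeless_ugraph)

lemma split_join_simps:
  "pverts (split_join s c t) = Inl ` {..<s} \<union> (\<lambda>i. Inr (Inl i)) ` {..<c} \<union> (\<lambda>i. Inr (Inr i)) ` {..<t}"
  "(Inl i, Inl j) \<in> parcs (split_join s c t) \<longleftrightarrow> i < s \<and> j < s \<and> i \<noteq> j"
  "(Inl i, Inr (Inl j)) \<in> parcs (split_join s c t) \<longleftrightarrow> i < s \<and> j < c"
  "(Inl i, Inr (Inr j)) \<in> parcs (split_join s c t) \<longleftrightarrow> i < s \<and> j < t"
  "(Inr (Inl i), Inl j) \<in> parcs (split_join s c t) \<longleftrightarrow> i < c \<and> j < s"
  "(Inr (Inl i), Inr (Inl j)) \<in> parcs (split_join s c t) \<longleftrightarrow> i < c \<and> j < c \<and> i \<noteq> j"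
  "(Inr (Inl i), Inr (Inr j)) \<notin> parcs (split_join s c t)"
  "(Inr (Inr i), Inl j) \<in> parcs (split_join s c t) \<longleftrightarrow> i < t \<and> j < s"
  "(Inr (Inr i), Inr (Inl j)) \<notin> parcs (split_join s c t)"
  "(Inr (Inr i), Inr (Inr j)) \<notin> parcs (split_join s c t)"
  by (force simp: split_join_def graph_join_def disjoint_union_def complete_ugraph_def
      edgeless_ugraph_def)+

lemma split_join_radius_ge:
  fixes q :: real
  assumes "s > 0" and "q - s - 2 * c + 2 > 0" "q - s > 0" and "join_cubic s c t q = 0"
  shows "q \<le> signless_laplacian_radius (split_join s c t)"
proof -
  let ?H = "split_join s c t"
  let ?S = "Inl ` {..<s} :: (nat + nat + nat) set" and ?C = "(\<lambda>i. Inr (Inl i)) ` {..<c} :: (nat + nat + nat) set"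
    and ?T = "(\<lambda>i. Inr (Inr i)) ` {..<t} :: (nat + nat + nat) set"
  interpret pair_graph ?H by (rule pair_graph_split_join)
  have card: "card ?S = s" "card ?C = c" "card ?T = t"
    by (simp_all add: card_image inj_on_def)
  have nb: "neighbours ?H v = join_nbhd ?S ?C ?T v" if "v \<in> pverts ?H" for v
    using that unfolding split_join_simps
    by (auto simp: set_eq_iff mem_neighbours_iff split_join_simps join_nbhd_def
        split_sum_all image_iff)
  have eq: "(\<Sum>u\<in>neighbours ?H v. join_weight ?S ?C q v + join_weight ?S ?C q u) =
      q * join_weight ?S ?C q v" if v: "v \<in> pverts ?H" for v
    unfolding nb[OF v]
    by (subst signless_laplacian_join_weight) (use v assms in \<open>auto simp: card split_join_simps\<close>)
  have "Inl 0 \<in> pverts ?H" "join_weight ?S ?C q (Inl 0) \<noteq> 0"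
    using assms(1) by (auto simp: split_join_simps join_weight_def)
  then have "eigenvalue (signless_laplacian ?H (vertex_enum ?H)) q"
    unfolding eigenvalue_iff using eq by blast
  then show ?thesis
    using signless_laplacian_radius_eigenvalue(2) \<open>Inl 0 \<in> pverts ?H\<close> by blast
qed

text \<open>
  The weight of the full split join is a supersolution on every spanning subgraph, since all
  summands are positive. It is strict on S if the cubic is positive, and strict at an end of any
  missing edge.
\<close>

lemma (in pair_graph) radius_less_of_join_nbhd:
  fixes q :: real
  assumes con: "Digraph_Component.connected (with_proj G)"
    and V: "pverts G = S \<union> C \<union> T"
    and disj: "S \<inter> C = {}" "S \<inter> T = {}" "C \<inter> T = {}"
    and q: "q - card S - 2 * card C + 2 > 0" "q - card S > 0"
    and nb: "\<And>v. v \<in> pverts G \<Longrightarrow> neighbours G v \<subseteq> join_nbhd S C T v"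
    and "S \<noteq> {}" and cubic: "join_cubic (card S) (card C) (card T) q \<ge> 0"
    and strict: "join_cubic (card S) (card C) (card T) q > 0 \<or>
      (\<exists>v\<in>pverts G. neighbours G v \<noteq> join_nbhd S C T v)"
  shows "signless_laplacian_radius G < q"
proof -
  let ?f = "join_weight S C q"
  have fin: "finite S" "finite C" "finite T" using V pair_finite_verts by auto
  have sS: "card S > 0" using fin \<open>S \<noteq> {}\<close> by auto
  have pos: "?f v > 0" for v using q sS by (simp add: join_weight_def)
  let ?d = "join_cubic (card S) (card C) (card T) q / ((q - card S - 2 * card C + 2) * (q - card S))"
  have d: "?d \<ge> 0" using cubic q by (intro divide_nonneg_pos mult_pos_pos) auto
  have finN: "finite (join_nbhd S C T v)" for v using fin by (simp add: join_nbhd_def)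
  have eq: "(\<Sum>u\<in>join_nbhd S C T v. ?f v + ?f u) = q * ?f v - (if v \<in> S then ?d else 0)"
    if "v \<in> pverts G" for v
    using signless_laplacian_join_weight[OF fin disj q] that V by simp
  have le: "(\<Sum>u\<in>neighbours G v. ?f v + ?f u) \<le> (\<Sum>u\<in>join_nbhd S C T v. ?f v + ?f u)"
    if "v \<in> pverts G" for v
    using pos by (intro sum_mono2[OF finN nb[OF that]] add_nonneg_nonneg less_imp_le) auto
  have "\<exists>w\<in>pverts G. (\<Sum>u\<in>neighbours G w. ?f w + ?f u) < q * ?f w"
    using strict
  proof
    assume "join_cubic (card S) (card C) (card T) q > 0"
    then have "?d > 0" using q by (intro divide_pos_pos mult_pos_pos) auto
    moreover obtain w where "w \<in> S" using \<open>S \<noteq> {}\<close> by blast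
    ultimately show ?thesis using le[of w] eq[of w] V by (intro bexI[of _ w]) auto
  next
    assume "\<exists>v\<in>pverts G. neighbours G v \<noteq> join_nbhd S C T v"
    then obtain w z where w: "w \<in> pverts G" and z: "z \<in> join_nbhd S C T w - neighbours G w"
      using nb by blast
    have "(\<Sum>u\<in>neighbours G w. ?f w + ?f u) < (\<Sum>u\<in>join_nbhd S C T w. ?f w + ?f u)"
      using pos z by (intro sum_strict_mono2[OF finN nb[OF w] z] add_pos_pos add_nonneg_nonneg less_imp_le) auto
    then show ?thesis using eq[OF w] d w by (intro bexI[of _ w]) (auto split: if_splits)
  qed
  then obtain w where w: "w \<in> pverts G" "(\<Sum>u\<in>neighbours G w. ?f w + ?f u) < q * ?f w" by blast
  have "eigenvalue (signless_laplacian G (vertex_enum G)) (signless_laplacian_radius G)"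
    using w(1) by (intro signless_laplacian_radius_eigenvalue(1)) auto
  moreover have "(\<Sum>u\<in>neighbours G v. ?f v + ?f u) \<le> q * ?f v" if "v \<in> pverts G" for v
    using le[OF that] eq[OF that] d by (auto split: if_splits)
  ultimately show ?thesis using eigenvalue_less_of_supersolution[OF con _ _ w] pos by blast
qed

lemma digraph_iso_of_bij:
  assumes wf: "wf_digraph (with_proj G)" and bij: "bij_betw \<phi> (pverts G) (pverts H)"
    and G: "parcs G \<subseteq> pverts G \<times> pverts G" and H: "parcs H \<subseteq> pverts H \<times> pverts H"
    and adj: "\<And>u v. u \<in> pverts G \<Longrightarrow> v \<in> pverts G \<Longrightarrow> (u, v) \<in> parcs G \<longleftrightarrow> (\<phi> u, \<phi> v) \<in> parcs H"
  shows "digraph_iso (with_proj G) (with_proj H)"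
proof -
  let ?hom = "\<lparr>iso_verts = \<phi>, iso_arcs = map_prod \<phi> \<phi>, iso_head = snd, iso_tail = fst\<rparr>"
  have inj: "inj_on \<phi> (pverts G)" and im: "\<phi> ` pverts G = pverts H"
    using bij by (auto simp: bij_betw_def)
  have "inj_on (map_prod \<phi> \<phi>) (parcs G)"
    by (rule inj_on_subset[OF map_prod_inj_on[OF inj inj] G])
  then have "pre_digraph.digraph_isomorphism (with_proj G) ?hom"
    using wf inj by (simp add: pre_digraph.digraph_isomorphism_def)
  moreover have "map_prod \<phi> \<phi> ` parcs G = parcs H"
  proof
    show "map_prod \<phi> \<phi> ` parcs G \<subseteq> parcs H"
    proof
      fix p assume "p \<in> map_prod \<phi> \<phi> ` parcs G"
      then obtain u v where uv: "p = (\<phi> u, \<phi> v)" "(u, v) \<in> parcs G" by auto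
      then have "u \<in> pverts G" "v \<in> pverts G" using G by blast+
      from adj[OF this] show "p \<in> parcs H" using uv by simp
    qed
    show "parcs H \<subseteq> map_prod \<phi> \<phi> ` parcs G"
    proof (rule subrelI)
      fix x y assume xy: "(x, y) \<in> parcs H"
      then have "x \<in> \<phi> ` pverts G" "y \<in> \<phi> ` pverts G" using H im by blast+
      then obtain u v where uv: "u \<in> pverts G" "v \<in> pverts G" "x = \<phi> u" "y = \<phi> v"
        by (elim imageE) blast
      then have "(u, v) \<in> parcs G" using adj[OF uv(1,2)] xy by simp
      then show "(x, y) \<in> map_prod \<phi> \<phi> ` parcs G"
        using uv by (intro image_eqI[of _ _ "(u, v)"]) auto
    qed
  qed
  then have "with_proj H = app_iso ?hom (with_proj G)"
    using im by (simp add: app_iso_def with_proj_def)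
  ultimately show ?thesis unfolding digraph_iso_def by blast
qed

lemma (in pair_graph) digraph_iso_split_join:
  assumes V: "pverts G = S \<union> C \<union> T"
    and disj: "S \<inter> C = {}" "S \<inter> T = {}" "C \<inter> T = {}"
    and nb: "\<And>v. v \<in> pverts G \<Longrightarrow> neighbours G v = join_nbhd S C T v"
  shows "digraph_iso (with_proj G) (with_proj (split_join (card S) (card C) (card T)))"
proof -
  let ?H = "split_join (card S) (card C) (card T)"
  interpret H: pair_graph ?H by (rule pair_graph_split_join)
  have fin: "finite S" "finite C" "finite T" using V pair_finite_verts by auto
  obtain a where a: "bij_betw a S {..<card S}"
    using ex_bij_betw_finite_nat[OF fin(1)] by (auto simp: atLeast0LessThan)
  obtain b where b: "bij_betw b C {..<card C}"
    using ex_bij_betw_finite_nat[OF fin(2)] by (auto simp: atLeast0LessThan)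
  obtain d where d: "bij_betw d T {..<card T}"
    using ex_bij_betw_finite_nat[OF fin(3)] by (auto simp: atLeast0LessThan)
  define \<phi> where "\<phi> v = (if v \<in> S then Inl (a v) else if v \<in> C then Inr (Inl (b v))
    else Inr (Inr (d v)))" for v
  have ph: "\<And>v. v \<in> S \<Longrightarrow> \<phi> v = Inl (a v)" "\<And>v. v \<in> C \<Longrightarrow> \<phi> v = Inr (Inl (b v))"
    "\<And>v. v \<in> T \<Longrightarrow> \<phi> v = Inr (Inr (d v))"
    using disj by (auto simp: \<phi>_def)
  have inj: "\<And>u v. u \<in> S \<Longrightarrow> v \<in> S \<Longrightarrow> a u = a v \<longleftrightarrow> u = v"
    "\<And>u v. u \<in> C \<Longrightarrow> v \<in> C \<Longrightarrow> b u = b v \<longleftrightarrow> u = v"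
    "\<And>u v. u \<in> T \<Longrightarrow> v \<in> T \<Longrightarrow> d u = d v \<longleftrightarrow> u = v"
    using a b d by (auto dest: bij_betw_imp_inj_on inj_onD)
  have lt: "\<And>v. v \<in> S \<Longrightarrow> a v < card S" "\<And>v. v \<in> C \<Longrightarrow> b v < card C"
    "\<And>v. v \<in> T \<Longrightarrow> d v < card T"
    using a b d by (auto dest: bij_betwE)
  have "\<phi> ` pverts G = pverts ?H"
  proof -
    have "\<phi> ` pverts G = Inl ` a ` S \<union> (\<lambda>i. Inr (Inl i)) ` b ` C \<union> (\<lambda>i. Inr (Inr i)) ` d ` T"
      unfolding V image_Un by (auto simp: ph image_image)
    then show ?thesis
      using a b d by (simp add: bij_betw_imp_surj_on split_join_simps)
  qed
  moreover have "inj_on \<phi> (pverts G)"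
    unfolding V by (auto simp: inj_on_def ph inj)
  ultimately have bij: "bij_betw \<phi> (pverts G) (pverts ?H)" by (simp add: bij_betw_def)
  show ?thesis
  proof (rule digraph_iso_of_bij[OF _ bij])
    show "wf_digraph (with_proj G)" by unfold_locales
    show "parcs G \<subseteq> pverts G \<times> pverts G" using wellformed' by auto
    show "parcs ?H \<subseteq> pverts ?H \<times> pverts ?H" using H.wellformed' by auto
    fix u v assume uv: "u \<in> pverts G" "v \<in> pverts G"
    have "(u, v) \<in> parcs G \<longleftrightarrow> v \<in> join_nbhd S C T u"
      using nb[OF uv(1)] mem_neighbours_iff by blast
    also have "\<dots> \<longleftrightarrow> (\<phi> u, \<phi> v) \<in> parcs ?H"
      using uv disj unfolding V
      by (auto simp: ph split_join_simps lt inj join_nbhd_def)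
    finally show "(u, v) \<in> parcs G \<longleftrightarrow> (\<phi> u, \<phi> v) \<in> parcs ?H" .
  qed
qed

section \<open>Extremal graphs\<close>

text \<open>
  Both parts of the theorem in one statement: what differs between them is why the barrier S has
  at least s vertices, and why the cubic is positive at the shifted parameters.
\<close>

lemma (in pair_graph) fractional_extendable_or_iso_split_join:
  fixes k s c t :: nat
  assumes con: "Digraph_Component.connected (with_proj G)"
    and k: "k \<ge> 1" "2 * k \<le> s" "2 * k + 2 \<le> card (pverts G)"
    and t: "t = s - 2 * k + 1" and c: "card (pverts G) = s + c + t" "c \<ge> 1"
    and deg: "s = 2 * k \<or> (\<forall>v\<in>pverts G. s \<le> vertex_degree G v)"
    and pos: "\<And>e i. e > 0 \<Longrightarrow> e * (real s + real c) \<ge> real t * real s \<Longrightarrow>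
        join_cubic s c t (2 * (real s + real c - 1) + e) = 0 \<Longrightarrow> 1 \<le> i \<Longrightarrow> 2 * i \<le> c \<Longrightarrow>
        join_cubic (real s + real i) (real c - 2 * real i) (real t + real i)
          (2 * (real s + real c - 1) + e) > 0"
    and rad: "signless_laplacian_radius (split_join s c t) \<le> signless_laplacian_radius G"
  shows "fractional_extendable k G \<or> digraph_iso (with_proj G) (with_proj (split_join s c t))"
proof (rule ccontr)
  assume *: "\<not> ?thesis"
  then obtain S T where S: "S \<subseteq> pverts G" "2 * k \<le> card S"
    and T: "T \<subseteq> pverts G - S" "card T = card S - 2 * k + 1" "\<And>v. v \<in> T \<Longrightarrow> neighbours G v \<subseteq> S"
    using not_fractional_extendable_obtains[OF k(3)] by metis
  define C where "C = pverts G - S - T"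
  have V: "pverts G = S \<union> C \<union> T" using S T by (auto simp: C_def)
  have disj: "S \<inter> C = {}" "S \<inter> T = {}" "C \<inter> T = {}" using T by (auto simp: C_def)
  have fin: "finite S" "finite C" "finite T" using V pair_finite_verts by auto
  have "s \<le> card S"
  proof -
    have "T \<noteq> {}" using T(2) by auto
    then obtain v where v: "v \<in> T" by blast
    have "vertex_degree G v \<le> card S"
      unfolding vertex_degree_eq using T(3)[OF v] fin by (intro card_mono)
    moreover have "v \<in> pverts G" using v V by blast
    ultimately show ?thesis using deg S(2) by (auto intro: order_trans)
  qed
  then obtain i where i: "card S = s + i" using le_Suc_ex by blast
  have cT: "card T = t + i" using T(2) i t k by simp
  have "card (pverts G) = card S + card C + card T"
    unfolding V using fin disj by (simp add: card_Un_disjoint Int_Un_distrib2)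
  then have cC: "c = card C + 2 * i" using c i cT by simp
  have "real s \<ge> 1" "real c \<ge> 1" "real t \<ge> 1" using k c t by auto
  then obtain e where e: "e > 0" "e * (real s + real c) \<ge> real t * real s"
    "join_cubic s c t (2 * (real s + real c - 1) + e) = 0"
    by (rule join_cubic_root_exists)
  define q where "q = 2 * (real s + real c - 1) + e"
  have "q \<le> signless_laplacian_radius (split_join s c t)"
    using k c e by (intro split_join_radius_ge) (auto simp: q_def)
  moreover have "signless_laplacian_radius G < q"
  proof (rule radius_less_of_join_nbhd[OF con V disj])
    show "q - card S - 2 * card C + 2 > 0" "q - card S > 0"
      using e k c cC unfolding q_def i by auto
    show "S \<noteq> {}" using i k by auto
    show "neighbours G v \<subseteq> join_nbhd S C T v" if "v \<in> pverts G" for v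
    proof -
      have "u \<in> join_nbhd S C T v" if u: "u \<in> neighbours G v" for u
      proof -
        have uv: "u \<noteq> v" "u \<in> pverts G" using u not_self_neighbour neighbours_subset by auto
        have "v \<in> neighbours G u" using u neighbours_sym[of u v] by simp
        then have uT: "v \<in> S" if "u \<in> T" using T(3)[OF that] by (rule subsetD[rotated])
        have vT: "u \<in> S" if "v \<in> T" using T(3)[OF that] u by (rule subsetD)
        consider "v \<in> S" | "v \<in> C" "v \<notin> S" | "v \<in> T" "v \<notin> S" "v \<notin> C"
          using \<open>v \<in> pverts G\<close> V disj by blast
        then show ?thesis
        proof cases
          case 1
          then show ?thesis using uv V by (simp add: join_nbhd_def)
        next
          case 2
          then have "u \<notin> T" using uT by blast
          then show ?thesis using 2 uv V by (simp add: join_nbhd_def)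
        next
          case 3
          then show ?thesis using vT by (simp add: join_nbhd_def)
        qed
      qed
      then show ?thesis by blast
    qed
    have cards: "real (card S) = real s + real i" "real (card C) = real c - 2 * real i"
      "real (card T) = real t + real i"
      using i cT cC by auto
    have "i = 0 \<or> join_cubic (card S) (card C) (card T) q > 0"
      using pos[OF e, of i] cC unfolding cards q_def by (cases i) auto
    moreover have "\<exists>v\<in>pverts G. neighbours G v \<noteq> join_nbhd S C T v" if "i = 0"
    proof (rule ccontr)
      assume "\<not> ?thesis"
      then have "digraph_iso (with_proj G) (with_proj (split_join (card S) (card C) (card T)))"
        by (intro digraph_iso_split_join[OF V disj]) auto
      then show False using * that i cT cC by simp
    qed
    ultimately show "join_cubic (card S) (card C) (card T) q > 0 \<or>
        (\<exists>v\<in>pverts G. neighbours G v \<noteq> join_nbhd S C T v)" by blast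
    show "join_cubic (card S) (card C) (card T) q \<ge> 0"
      using \<open>i = 0 \<or> _\<close> e(3) unfolding cards q_def by auto
  qed
  ultimately show False using rad by simp
qed

theorem theorem1p6:
  fixes G :: "'a pair_pre_digraph" and k n \<delta> :: nat
  assumes "k \<ge> 1"
    and "pair_graph G"
    and "Digraph_Component.connected (with_proj G)"
    and "card (pverts G) = n"
    and "min_degree G = \<delta>"
  shows
    "(n \<ge> 2 * k + 6 \<and>
      signless_laplacian_radius G \<ge> signless_laplacian_radius
        (graph_join (complete_ugraph (2 * k))
          (disjoint_union (complete_ugraph (n - 2 * k - 1)) (complete_ugraph 1)))
      \<longrightarrow> fractional_extendable k G \<or>
          digraph_iso (with_proj G) (with_proj
            (graph_join (complete_ugraph (2 * k))
              (disjoint_union (complete_ugraph (n - 2 * k - 1)) (complete_ugraph 1)))))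
     \<and>
     (real n \<ge> 6.5 * real \<delta> \<and> \<delta> \<ge> 2 * k + 1 \<and>
      signless_laplacian_radius G \<ge> signless_laplacian_radius
        (graph_join (complete_ugraph \<delta>)
          (disjoint_union (complete_ugraph (n - 2 * \<delta> + 2 * k - 1))
            (edgeless_ugraph (\<delta> - 2 * k + 1))))
      \<longrightarrow> fractional_extendable k G \<or>
          digraph_iso (with_proj G) (with_proj
            (graph_join (complete_ugraph \<delta>)
              (disjoint_union (complete_ugraph (n - 2 * \<delta> + 2 * k - 1))
                (edgeless_ugraph (\<delta> - 2 * k + 1))))))"
proof (intro conjI impI; elim conjE)
  interpret pair_graph G by fact
  assume n: "n \<ge> 2 * k + 6" and rad: "signless_laplacian_radius G \<ge> signless_laplacian_radius
        (graph_join (complete_ugraph (2 * k))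
          (disjoint_union (complete_ugraph (n - 2 * k - 1)) (complete_ugraph 1)))"
  define c where "c = n - 2 * k - 1"
  have "complete_ugraph 1 = edgeless_ugraph 1"
    by (auto simp: complete_ugraph_def edgeless_ugraph_def)
  then have H: "graph_join (complete_ugraph (2 * k))
      (disjoint_union (complete_ugraph (n - 2 * k - 1)) (complete_ugraph 1)) =
      split_join (2 * k) c 1"
    by (simp add: split_join_def c_def)
  show "fractional_extendable k G \<or>
          digraph_iso (with_proj G) (with_proj
            (graph_join (complete_ugraph (2 * k))
              (disjoint_union (complete_ugraph (n - 2 * k - 1)) (complete_ugraph 1))))"
    unfolding H
  proof (rule fractional_extendable_or_iso_split_join[OF assms(3,1)])
    fix e :: real and i :: nat
    assume e: "e > 0"
      and root: "join_cubic (real (2 * k)) (real c) (real 1) (2 * (real (2 * k) + real c - 1) + e) = 0"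
      and i: "1 \<le> i" "2 * i \<le> c"
    show "join_cubic (real (2 * k) + real i) (real c - 2 * real i) (real 1 + real i)
        (2 * (real (2 * k) + real c - 1) + e) > 0"
    proof (cases "c = 5")
      case True
      then show ?thesis
        using join_cubic_pos_one_isolated_five[of "real (2 * k)" e "real i"] e root i assms(1) by simp
    next
      case False
      then have "c \<ge> 6" using n by (simp add: c_def)
      then show ?thesis
        using join_cubic_pos_one_isolated[of "real (2 * k)" "real c" e "real i"] e root i assms(1) by simp
    qed
  next
    show "signless_laplacian_radius (split_join (2 * k) c 1) \<le> signless_laplacian_radius G"
      using rad unfolding H .
    show "card (pverts G) = 2 * k + c + 1" "c \<ge> 1" using n assms(4) by (auto simp: c_def)
  qed (use n assms(4) in auto)
next
  interpret pair_graph G by fact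
  assume n: "real n \<ge> 6.5 * real \<delta>" and \<delta>: "\<delta> \<ge> 2 * k + 1"
    and rad: "signless_laplacian_radius G \<ge> signless_laplacian_radius
        (graph_join (complete_ugraph \<delta>)
          (disjoint_union (complete_ugraph (n - 2 * \<delta> + 2 * k - 1))
            (edgeless_ugraph (\<delta> - 2 * k + 1))))"
  define c where "c = n - 2 * \<delta> + 2 * k - 1"
  define t where "t = \<delta> - 2 * k + 1"
  have H: "graph_join (complete_ugraph \<delta>)
      (disjoint_union (complete_ugraph (n - 2 * \<delta> + 2 * k - 1)) (edgeless_ugraph (\<delta> - 2 * k + 1))) =
      split_join \<delta> c t"
    by (simp add: split_join_def c_def t_def)
  have "real n \<ge> real (6 * \<delta>)" using n by simp
  then have n6: "n \<ge> 6 * \<delta>" by linarith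
  have card: "n = \<delta> + c + t" using n6 \<delta> by (simp add: c_def t_def)
  show "fractional_extendable k G \<or>
          digraph_iso (with_proj G) (with_proj
            (graph_join (complete_ugraph \<delta>)
              (disjoint_union (complete_ugraph (n - 2 * \<delta> + 2 * k - 1))
                (edgeless_ugraph (\<delta> - 2 * k + 1)))))"
    unfolding H
  proof (rule fractional_extendable_or_iso_split_join[OF assms(3,1)])
    fix e :: real and i :: nat
    assume e: "e > 0" "e * (real \<delta> + real c) \<ge> real t * real \<delta>"
      and root: "join_cubic \<delta> c t (2 * (real \<delta> + real c - 1) + e) = 0"
      and i: "1 \<le> i" "2 * i \<le> c"
    have "real t \<ge> 1" "real t \<le> real \<delta> - 1" using \<delta> assms(1) by (auto simp: t_def)
    moreover have "real c \<ge> 5.5 * real \<delta> - real t" using n card by simp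
    ultimately show "join_cubic (real \<delta> + real i) (real c - 2 * real i) (real t + real i)
        (2 * (real \<delta> + real c - 1) + e) > 0"
      using join_cubic_pos_few_isolated[of "real \<delta>" "real c" "real t" e "real i"] e root i by simp
  next
    have "\<delta> \<le> vertex_degree G v" if "v \<in> pverts G" for v
      unfolding assms(5)[symmetric] min_degree_def using that pair_finite_verts by (intro Min_le) auto
    then show "\<delta> = 2 * k \<or> (\<forall>v\<in>pverts G. \<delta> \<le> vertex_degree G v)" by blast
    show "signless_laplacian_radius (split_join \<delta> c t) \<le> signless_laplacian_radius G"
      using rad unfolding H .
    show "t = \<delta> - 2 * k + 1" by (fact t_def)
    show "c \<ge> 1" using n6 \<delta> by (simp add: c_def)
    show "card (pverts G) = \<delta> + c + t" using card assms(4) by simp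
    show "2 * k + 2 \<le> card (pverts G)" using n6 \<delta> unfolding assms(4) by linarith
    show "2 * k \<le> \<delta>" using \<delta> by simp
  qed
qed

end
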